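(* Let $\|\cdot\|$ be a compatible unitarily invariant norm with associated symmetric gauge function $\psi$. Let $\{V_i\}_{i=1}^m$ be the coordinate operators of an $(m,l,d)$-protocol on the Hilbert space $\mathcal H$, with analysis operator $V$. Then $$e_1^\psi(V)\ge \frac{d\cdot\eta_\psi(l)}{m}.$$ Moreover, if $\|\cdot\|$ is strict, then equality holds if and only if $\{V_i\}_{i=1}^m$ is a uniformly weighted projective rank-$l$ $(m,l,d)$-protocol.
   Context: $\mathbb F$ is $\mathbb R$ or $\mathbb C$; $\mathcal H=\mathbb F^d$, $\mathcal K=\mathbb F^l$. Standing assumptions: $l<d<ml$. An $(m,l,d)$-protocol on $\mathcal H$ is a family $\{V_i\}_{i=1}^m$ of linear operators $V_i:\mathcal H\to\mathcal K$ (its coordinate operators) with $\sum_{i=1}^m V_i^*V_i=I_d$. Its analysis operator is $V:\mathcal H\to\bigoplus_{i=1}^m\mathcal K$, $Vx=\bigoplus_{i=1}^m V_ix$. It is projective if for each $i$, $V_i^*V_i=w_iP_i$ with $P_i$ an orthogonal projection on $\mathcal H$ and weight $w_i>0$; uniformly weighted projective (u.w.p.) if in addition all $w_i$ are equal; rank-$l$ if $\operatorname{rank}(V_i^* )=l$ for all $i$. A compatible unitarily invariant norm is a sequence $\{\|\cdot\|_n\}_{n\in\mathbb N}$, with $\|\cdot\|_n$ a unitarily invariant norm on $M_n(\mathbb F)$, such that $\left\|\begin{pmatrix}X&0\\0&\mathbf 0_t\end{pmatrix}\right\|_{r+t}=\|X\|_r$ for all $r,t$ and $X\in M_r(\mathbb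 F)$, where $\mathbf 0_t$ is the $t\times t$ zero matrix. If $\psi_n$ is the associated symmetric gauge function ($\|A\|_n=\psi_n(s(A))$, $s(A)$ the vector of singular values), this is equivalent to $\psi_{r+t}(x,0_t)=\psi_r(x)$ for $x\in\mathbb R^r$; one writes $\|\cdot\|$ and $\psi$ for all orders. Put $\eta_\psi(l)=\frac{\psi(\mathbf e_l)}{l}$ with $\mathbf e_l=(1,\dots,1)\in\mathbb R^l$. The compatible norm is strict if for every $n$ and every positive semidefinite $A\in M_n(\mathbb F)$, $\|A\|=\operatorname{tr}(A)\,\eta_\psi(n)$ implies $A=\frac{\operatorname{tr}(A)}{n}I_n$. For $\mathbb K\subseteq\{1,\dots,m\}$, the packet-lost operator $E_{\mathbb K}$ on $\bigoplus_{j=1}^m\mathcal K$ replaces $y_j$ by $0$ in $\bigoplus_j y_j$ for $j\in\mathbb K$ and leaves the other components unchanged. The worst-case reconstruction error for $p$ lost packets is $e_p^\psi(V)=\max\{\|V^*V-V^*E_{\mathbb K}V\|:\ \mathbb K\subseteq\{1,\dots,m\},\ |\mathbb K|=p\}$. *)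

theory Defs
  imports
    "HOL-Combinatorics.Permutations"
    "HOL-Computational_Algebra.Polynomial"
    "Jordan_Normal_Form.Schur_Decomposition"
    "Jordan_Normal_Form.DL_Rank"
begin

text \<open>
  The scalar field is \<^typ>\<open>real\<close> or \<^typ>\<open>complex\<close>. The definitions are polymorphic over a
  sort that contains both and are only meant for these two instances; there
  \<^const>\<open>conjugate\<close> is complex conjugation (the identity on \<^typ>\<open>real\<close>), and
  \<open>z \<ge> 0\<close> says that \<open>z\<close> is a nonnegative real number. Linear operators
  are matrices with respect to the standard bases; all indices start at 0.
\<close>

definition mat_trace :: "'a::comm_monoid_add mat \<Rightarrow> 'a" where
  "mat_trace A = (\<Sum>i<dim_row A. A $$ (i, i))"

definition mat_unitary :: "nat \<Rightarrow> 'a::conjugatable_field mat \<Rightarrow> bool" where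
  "mat_unitary n U \<longleftrightarrow> U \<in> carrier_mat n n \<and> mat_adjoint U * U = 1\<^sub>m n \<and> U * mat_adjoint U = 1\<^sub>m n"

definition psd :: "nat \<Rightarrow> 'a::conjugatable_ordered_field mat \<Rightarrow> bool" where
  "psd n A \<longleftrightarrow> A \<in> carrier_mat n n \<and> mat_adjoint A = A \<and>
     (\<forall>x\<in>carrier_vec n. 0 \<le> (A *\<^sub>v x) \<bullet>c x)"

definition orth_projection :: "nat \<Rightarrow> 'a::conjugatable_field mat \<Rightarrow> bool" where
  "orth_projection n P \<longleftrightarrow> P \<in> carrier_mat n n \<and> P * P = P \<and> mat_adjoint P = P"

text \<open>
  The singular values of \<open>A\<close> are the square roots of the eigenvalues of \<open>A\<^sup>* A\<close>, listed with
  algebraic multiplicity in decreasing order. Since these eigenvalues are nonnegative reals,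
  \<^const>\<open>norm\<close> merely casts them from the scalar field to \<^typ>\<open>real\<close>.
\<close>

definition singular_values ::
    "'a::{conjugatable_ordered_field, real_normed_field} mat \<Rightarrow> real vec" where
  "singular_values A = vec_of_list (rev (sorted_list_of_multiset
     (image_mset (\<lambda>z. sqrt (norm z)) (proots (char_poly (mat_adjoint A * A))))))"

definition ui_norm ::
    "nat \<Rightarrow> ('a::{conjugatable_ordered_field, real_normed_field} mat \<Rightarrow> real) \<Rightarrow> bool" where
  "ui_norm n N \<longleftrightarrow>
     (\<forall>A\<in>carrier_mat n n. 0 \<le> N A \<and> (N A = 0 \<longleftrightarrow> A = 0\<^sub>m n n)) \<and>
     (\<forall>A\<in>carrier_mat n n. \<forall>c. N (c \<cdot>\<^sub>m A) = norm c * N A) \<and>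
     (\<forall>A\<in>carrier_mat n n. \<forall>B\<in>carrier_mat n n. N (A + B) \<le> N A + N B) \<and>
     (\<forall>A\<in>carrier_mat n n. \<forall>U W. mat_unitary n U \<longrightarrow> mat_unitary n W \<longrightarrow> N (U * A * W) = N A)"

definition compatible_ui_norm ::
    "(nat \<Rightarrow> 'a::{conjugatable_ordered_field, real_normed_field} mat \<Rightarrow> real) \<Rightarrow> bool" where
  "compatible_ui_norm N \<longleftrightarrow>
     (\<forall>n>0. ui_norm n (N n)) \<and>
     (\<forall>r>0. \<forall>t. \<forall>X\<in>carrier_mat r r.
        N (r + t) (four_block_mat X (0\<^sub>m r t) (0\<^sub>m t r) (0\<^sub>m t t)) = N r X)"

definition symmetric_gauge :: "nat \<Rightarrow> (real vec \<Rightarrow> real) \<Rightarrow> bool" where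
  "symmetric_gauge n g \<longleftrightarrow>
     (\<forall>x\<in>carrier_vec n. 0 \<le> g x \<and> (g x = 0 \<longleftrightarrow> x = 0\<^sub>v n)) \<and>
     (\<forall>x\<in>carrier_vec n. \<forall>c. g (c \<cdot>\<^sub>v x) = \<bar>c\<bar> * g x) \<and>
     (\<forall>x\<in>carrier_vec n. \<forall>y\<in>carrier_vec n. g (x + y) \<le> g x + g y) \<and>
     (\<forall>x\<in>carrier_vec n. \<forall>\<sigma>. \<sigma> permutes {..<n} \<longrightarrow> g (vec n (\<lambda>i. x $ \<sigma> i)) = g x) \<and>
     (\<forall>x\<in>carrier_vec n. \<forall>\<epsilon>::nat \<Rightarrow> real. (\<forall>i<n. \<epsilon> i \<in> {1, -1}) \<longrightarrow>
        g (vec n (\<lambda>i. \<epsilon> i * x $ i)) = g x)"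

definition associated_gauge ::
    "(nat \<Rightarrow> 'a::{conjugatable_ordered_field, real_normed_field} mat \<Rightarrow> real) \<Rightarrow>
     (nat \<Rightarrow> real vec \<Rightarrow> real) \<Rightarrow> bool" where
  "associated_gauge N \<psi> \<longleftrightarrow>
     (\<forall>n>0. symmetric_gauge n (\<psi> n) \<and>
            (\<forall>A\<in>carrier_mat n n. N n A = \<psi> n (singular_values A)))"

definition eta :: "(nat \<Rightarrow> real vec \<Rightarrow> real) \<Rightarrow> nat \<Rightarrow> real" where
  "eta \<psi> n = \<psi> n (vec n (\<lambda>_. 1)) / real n"

definition strict_norm ::
    "(nat \<Rightarrow> 'a::{conjugatable_ordered_field, real_normed_field} mat \<Rightarrow> real) \<Rightarrow>
     (nat \<Rightarrow> real vec \<Rightarrow> real) \<Rightarrow> bool" where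
  "strict_norm N \<psi> \<longleftrightarrow>
     (\<forall>n>0. \<forall>A. psd n A \<longrightarrow> of_real (N n A) = mat_trace A * of_real (eta \<psi> n) \<longrightarrow>
        A = (mat_trace A / of_nat n) \<cdot>\<^sub>m 1\<^sub>m n)"

definition protocol :: "nat \<Rightarrow> nat \<Rightarrow> nat \<Rightarrow> (nat \<Rightarrow> 'a::conjugatable_field mat) \<Rightarrow> bool" where
  "protocol m l d V \<longleftrightarrow>
     (\<forall>i<m. V i \<in> carrier_mat l d) \<and>
     mat d d (\<lambda>(r, c). \<Sum>i<m. (mat_adjoint (V i) * V i) $$ (r, c)) = 1\<^sub>m d"

definition projective_weights ::
    "nat \<Rightarrow> nat \<Rightarrow> (nat \<Rightarrow> 'a::{conjugatable_field, real_normed_field} mat) \<Rightarrow>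
     (nat \<Rightarrow> real) \<Rightarrow> bool" where
  "projective_weights m d V w \<longleftrightarrow>
     (\<forall>i<m. 0 < w i \<and>
        (\<exists>P. orth_projection d P \<and> mat_adjoint (V i) * V i = of_real (w i) \<cdot>\<^sub>m P))"

definition uwp_protocol ::
    "nat \<Rightarrow> nat \<Rightarrow> nat \<Rightarrow> (nat \<Rightarrow> 'a::{conjugatable_field, real_normed_field} mat) \<Rightarrow> bool" where
  "uwp_protocol m l d V \<longleftrightarrow> protocol m l d V \<and>
     (\<exists>w. projective_weights m d V w \<and> (\<forall>i<m. \<forall>j<m. w i = w j))"

definition rank_l :: "nat \<Rightarrow> nat \<Rightarrow> nat \<Rightarrow> (nat \<Rightarrow> 'a::conjugatable_field mat) \<Rightarrow> bool" where
  "rank_l m l d V \<longleftrightarrow> (\<forall>i<m. vec_space.rank d (mat_adjoint (V i)) = l)"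

text \<open>
  The direct sum of \<open>m\<close> copies of the \<open>l\<close>-dimensional space is identified with the
  \<open>m * l\<close>-dimensional one: coordinate \<open>k\<close> is coordinate \<open>k mod l\<close> of packet \<open>k div l\<close>.
\<close>

definition analysis_op :: "nat \<Rightarrow> nat \<Rightarrow> nat \<Rightarrow> (nat \<Rightarrow> 'a mat) \<Rightarrow> 'a mat" where
  "analysis_op m l d V = mat (m * l) d (\<lambda>(k, c). V (k div l) $$ (k mod l, c))"

definition packet_lost :: "nat \<Rightarrow> nat \<Rightarrow> nat set \<Rightarrow> 'a::{zero, one} mat" where
  "packet_lost m l K =
     mat (m * l) (m * l) (\<lambda>(k, k'). if k = k' \<and> k div l \<notin> K then 1 else 0)"

definition worst_error ::
    "(nat \<Rightarrow> 'a::conjugatable_field mat \<Rightarrow> real) \<Rightarrow> nat \<Rightarrow> nat \<Rightarrow> nat \<Rightarrow>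
     (nat \<Rightarrow> 'a mat) \<Rightarrow> nat \<Rightarrow> real" where
  "worst_error N m l d V p =
     (let T = analysis_op m l d V in
      Max ((\<lambda>K. N d (mat_adjoint T * T - mat_adjoint T * packet_lost m l K * T)) `
           {K. K \<subseteq> {..<m} \<and> card K = p}))"

end

theory Submission
  imports Defs
begin

text \<open>
  Losing packet \<open>i\<close> costs the norm of \<open>V\<^sub>i\<^sup>* V\<^sub>i\<close>, and by compatibility this is the norm of the
  \<open>l\<close>-dimensional matrix \<open>V\<^sub>i V\<^sub>i\<^sup>*\<close>, since the two have the same singular values up to zeros. Averaging
  a matrix over sign changes and then over cyclic shifts of the coordinates turns it into
  \<open>tr(A)/l\<close> times the identity without increasing the norm, so \<open>\<parallel>A\<parallel> \<ge> \<bar>tr(A)\<bar> \<eta>(l)\<close>. The traces of the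
  \<open>V\<^sub>i V\<^sub>i\<^sup>*\<close> add up to \<open>d\<close>, which gives the bound. Equality forces all these traces to be \<open>d/m\<close>, and
  then strictness forces \<open>V\<^sub>i V\<^sub>i\<^sup>* = d/(ml) I\<close>; this says exactly that \<open>V\<^sub>i\<^sup>*\<close> is injective and
  \<open>V\<^sub>i\<^sup>* V\<^sub>i\<close> is \<open>d/(ml)\<close> times an orthogonal projection.
\<close>

section \<open>Adjoints, traces and positive semidefinite matrices\<close>

lemma conjugate_1 [simp]: "conjugate (1 :: 'a::conjugatable_field) = 1"
proof -
  \<comment> \<open>The conjugate of 1 is a nonzero idempotent of a field.\<close>
  have "conjugate (1::'a) * conjugate 1 = conjugate 1 * 1"
    using conjugate_dist_mul[of "1::'a" 1] by simp
  moreover have "conjugate (1::'a) \<noteq> 0" by (simp only: conjugate_zero_iff one_neq_zero not_False_eq_True)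
  ultimately show ?thesis by (metis mult_left_cancel)
qed

lemma dim_mat_adjoint [simp]:
  "dim_row (mat_adjoint A) = dim_col A" "dim_col (mat_adjoint A) = dim_row A"
  by (simp_all add: mat_adjoint_def)

lemma mat_adjoint_carrier [simp, intro]:
  "A \<in> carrier_mat n k \<Longrightarrow> mat_adjoint A \<in> carrier_mat k n"
  by (rule carrier_matI) auto

lemma index_mat_adjoint [simp]:
  "i < dim_col A \<Longrightarrow> j < dim_row A \<Longrightarrow> mat_adjoint A $$ (i, j) = conjugate (A $$ (j, i))"
  by (simp add: mat_adjoint_def mat_of_rows_def)

lemma mat_adjoint_adjoint [simp]: "mat_adjoint (mat_adjoint A) = A"
  by (rule eq_matI) auto

lemma index_mult_mat_sum:
  "i < dim_row A \<Longrightarrow> j < dim_col B \<Longrightarrow> dim_col A = dim_row B \<Longrightarrow>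
   (A * B) $$ (i, j) = (\<Sum>k<dim_row B. A $$ (i, k) * B $$ (k, j))"
  by (simp add: scalar_prod_def atLeast0LessThan)

lemma mat_adjoint_mult:
  assumes "A \<in> carrier_mat n k" "B \<in> carrier_mat k p"
  shows "mat_adjoint (A * B) = mat_adjoint B * mat_adjoint A"
proof (rule eq_matI)
  fix i j assume "i < dim_row (mat_adjoint B * mat_adjoint A)" "j < dim_col (mat_adjoint B * mat_adjoint A)"
  hence ij: "i < p" "j < n" using assms by auto
  hence "mat_adjoint (A * B) $$ (i, j) = (\<Sum>q<k. conjugate (B $$ (q, i)) * conjugate (A $$ (j, q)))"
    using assms by (simp add: index_mult_mat_sum sum_conjugate conjugate_dist_mul mult.commute
        del: index_mult_mat(1))
  thus "mat_adjoint (A * B) $$ (i, j) = (mat_adjoint B * mat_adjoint A) $$ (i, j)"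
    using assms ij by (simp add: index_mult_mat_sum del: index_mult_mat(1))
qed (use assms in auto)

lemma mat_adjoint_smult: "mat_adjoint (c \<cdot>\<^sub>m A) = conjugate c \<cdot>\<^sub>m mat_adjoint A"
  by (rule eq_matI) (auto simp: conjugate_dist_mul)

lemma mat_adjoint_one [simp]: "mat_adjoint (1\<^sub>m n) = 1\<^sub>m n"
  by (rule eq_matI) auto

lemma mat_adjoint_zero [simp]: "mat_adjoint (0\<^sub>m n k) = 0\<^sub>m k n"
  by (rule eq_matI) auto

lemma mat_adjoint_four_block:
  assumes "A \<in> carrier_mat n1 k1" "B \<in> carrier_mat n1 k2"
    "C \<in> carrier_mat n2 k1" "D \<in> carrier_mat n2 k2"
  shows "mat_adjoint (four_block_mat A B C D) =
    four_block_mat (mat_adjoint A) (mat_adjoint C) (mat_adjoint B) (mat_adjoint D)"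
  using assms by (intro eq_matI) (auto simp: less_diff_conv2)

lemma mat_trace_mult_commute:
  fixes A B :: "'a::comm_semiring_0 mat"
  assumes "A \<in> carrier_mat n k" "B \<in> carrier_mat k n"
  shows "mat_trace (A * B) = mat_trace (B * A)"
proof -
  have "mat_trace (A * B) = (\<Sum>i<n. \<Sum>j<k. A $$ (i, j) * B $$ (j, i))"
    using assms by (auto simp: mat_trace_def index_mult_mat_sum simp del: index_mult_mat(1) intro!: sum.cong)
  also have "\<dots> = (\<Sum>j<k. \<Sum>i<n. B $$ (j, i) * A $$ (i, j))"
    by (subst sum.swap) (simp add: mult.commute)
  also have "\<dots> = mat_trace (B * A)"
    using assms by (auto simp: mat_trace_def index_mult_mat_sum simp del: index_mult_mat(1) intro!: sum.cong)
  finally show ?thesis .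
qed

text \<open>The quadratic form at \<open>x\<close> is the squared length of \<open>y\<close>, the
  image of \<open>x\<close> under the adjoint of \<open>A\<close>.\<close>

lemma psd_mult_adjoint:
  fixes A :: "'a::conjugatable_ordered_field mat"
  assumes "A \<in> carrier_mat n k"
  shows "psd n (A * mat_adjoint A)"
proof -
  have "0 \<le> (A * mat_adjoint A *\<^sub>v x) \<bullet>c x" if x: "x \<in> carrier_vec n" for x
  proof -
    define y where "y = mat_adjoint A *\<^sub>v x"
    have y: "y \<in> carrier_vec k"
      using mult_mat_vec_carrier[OF mat_adjoint_carrier[OF assms] x] by (simp add: y_def)
    have yj: "y $ j = (\<Sum>i<n. conjugate (A $$ (i, j)) * x $ i)" if "j < k" for j
      using assms x that
      by (auto simp: y_def scalar_prod_def atLeast0LessThan intro!: sum.cong)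
    have "(A * mat_adjoint A *\<^sub>v x) \<bullet>c x = (A *\<^sub>v y) \<bullet>c x"
      using assms x by (simp add: y_def assoc_mult_mat_vec[of _ n k _ n])
    also have "\<dots> = (\<Sum>i<n. (\<Sum>j<k. A $$ (i, j) * y $ j) * conjugate (x $ i))"
      using assms x y by (auto simp: scalar_prod_def atLeast0LessThan intro!: sum.cong)
    also have "\<dots> = (\<Sum>i<n. \<Sum>j<k. y $ j * (A $$ (i, j) * conjugate (x $ i)))"
      by (simp add: sum_distrib_left sum_distrib_right ac_simps)
    also have "\<dots> = (\<Sum>j<k. y $ j * (\<Sum>i<n. A $$ (i, j) * conjugate (x $ i)))"
      by (subst sum.swap) (simp add: sum_distrib_left)
    also have "\<dots> = (\<Sum>j<k. y $ j * conjugate (y $ j))"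
      by (intro sum.cong) (auto simp: yj sum_conjugate conjugate_dist_mul)
    finally show ?thesis by (simp add: sum_nonneg conjugate_square_positive)
  qed
  thus ?thesis
    using assms by (auto simp: psd_def mat_adjoint_mult[of A n k "mat_adjoint A" n])
qed

section \<open>Characteristic polynomials of products and singular values of Gram matrices\<close>

text \<open>\<open>char_poly_matrix\<close> keeps the block triangular shape, so its determinant
  factors.\<close>

lemma char_poly_four_block_upper_right_zero:
  fixes A :: "'a::idom mat"
  assumes "A \<in> carrier_mat n n" "C \<in> carrier_mat k n" "D \<in> carrier_mat k k"
  shows "char_poly (four_block_mat A (0\<^sub>m n k) C D) = char_poly A * char_poly D"
proof -
  have "char_poly_matrix (four_block_mat A (0\<^sub>m n k) C D) =
      four_block_mat (char_poly_matrix A) (0\<^sub>m n k) (map_mat (\<lambda>a. [:-a:]) C) (char_poly_matrix D)"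
    using assms by (intro eq_matI) (auto simp: char_poly_matrix_def)
  thus ?thesis
    using assms by (simp add: char_poly_def det_four_block_mat_upper_right_zero[where n=n and m=k])
qed

lemma char_poly_diagonal_const:
  fixes A :: "'a::idom mat"
  assumes "A \<in> carrier_mat n n" "\<And>i j. i < n \<Longrightarrow> j < n \<Longrightarrow> A $$ (i, j) = (if i = j then c else 0)"
  shows "char_poly A = [:-c, 1:] ^ n"
proof -
  have "map (\<lambda>a. [:-a, 1:]) (diag_mat A) = map (\<lambda>_. [:-c, 1:]) [0..<n]"
    using assms by (auto simp: diag_mat_def)
  hence "map (\<lambda>a. [:-a, 1:]) (diag_mat A) = replicate n [:-c, 1:]"
    by (simp only: map_replicate_const length_upt diff_zero)
  moreover have "upper_triangular A" using assms by auto
  ultimately show ?thesis using assms by (simp add: char_poly_upper_triangular)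
qed

lemma char_poly_zero_mat: "char_poly (0\<^sub>m n n :: 'a::idom mat) = [:0, 1:] ^ n"
  by (subst char_poly_diagonal_const[of _ n 0]) auto

text \<open>Conjugation by the unipotent block matrix with upper right block \<open>X\<close> links
  the two products. Both matrices are block triangular, so the characteristic polynomials of
  \<open>X * Y\<close> and \<open>Y * X\<close> can be read off from the diagonal blocks.\<close>

lemma four_block_zero_right_similar:
  fixes X Y :: "'a::idom mat"
  assumes X: "X \<in> carrier_mat n k" and Y: "Y \<in> carrier_mat k n"
  shows "similar_mat (four_block_mat (X * Y) (0\<^sub>m n k) Y (0\<^sub>m k k))
     (four_block_mat (0\<^sub>m n n) (0\<^sub>m n k) Y (Y * X))"
proof (rule similar_matI)
  let ?P = "four_block_mat (1\<^sub>m n) X (0\<^sub>m k n) (1\<^sub>m k)"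
  let ?Q = "four_block_mat (1\<^sub>m n) (- X) (0\<^sub>m k n) (1\<^sub>m k)"
  let ?M = "four_block_mat (0\<^sub>m n n) (0\<^sub>m n k) Y (Y * X)"
  show "{four_block_mat (X * Y) (0\<^sub>m n k) Y (0\<^sub>m k k), ?M, ?P, ?Q} \<subseteq> carrier_mat (n + k) (n + k)"
    using X Y by auto
  have XX: "X + - X = 0\<^sub>m n k" and mz: "- 0\<^sub>m k k = (0\<^sub>m k k :: 'a mat)"
    using X by (auto intro!: eq_matI)
  show "?P * ?Q = 1\<^sub>m (n + k)" "?Q * ?P = 1\<^sub>m (n + k)"
    using X by (auto simp: mult_four_block_mat[of _ n n _ k _ k _ _ n _ k] mz XX uminus_l_inv_mat[of _ n k])
  have "?P * ?M = four_block_mat (X * Y) (X * (Y * X)) Y (Y * X)"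
    using X Y by (subst mult_four_block_mat[of _ n n _ k _ k _ _ n _ k]) auto
  moreover have "\<dots> * ?Q = four_block_mat (X * Y) (0\<^sub>m n k) Y (0\<^sub>m k k)"
    using X Y
    by (subst mult_four_block_mat[of _ n n _ k _ k _ _ n _ k])
       (auto simp: assoc_mult_mat[of _ n k _ n] uminus_l_inv_mat[of _ n k] uminus_l_inv_mat[of _ k k])
  ultimately show "four_block_mat (X * Y) (0\<^sub>m n k) Y (0\<^sub>m k k) = ?P * ?M * ?Q" by simp
qed

text \<open>By the block similarity, the two polynomials agree up to powers of the indeterminate
  coming from the zero blocks. As \<open>k \<le> n\<close>, the common power \<open>k\<close>
  cancels.\<close>

lemma char_poly_mult_commute:
  fixes X Y :: "'a::idom mat"
  assumes "X \<in> carrier_mat n k" "Y \<in> carrier_mat k n" "k \<le> n"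
  shows "char_poly (X * Y) = char_poly (Y * X) * [:0, 1:] ^ (n - k)"
proof -
  have "char_poly (X * Y) * [:0, 1:] ^ k = [:0, 1:] ^ n * char_poly (Y * X)"
    using char_poly_similar[OF four_block_zero_right_similar[OF assms(1,2)]] assms
    by (simp add: char_poly_four_block_upper_right_zero char_poly_zero_mat)
  also have "\<dots> = (char_poly (Y * X) * [:0, 1:] ^ (n - k)) * [:0, 1:] ^ k"
    using assms by (simp flip: power_add)
  finally show ?thesis by simp
qed

lemma singular_values_cong:
  "char_poly (mat_adjoint A * A) = char_poly (mat_adjoint B * B) \<Longrightarrow>
   singular_values A = singular_values B"
  by (simp add: singular_values_def)

text \<open>Both matrices are self-adjoint, so their singular values come from their squares. Each
  square has the characteristic polynomial of \<open>?A * ?A\<close> times the power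
  \<open>d - l\<close> of the indeterminate.\<close>

lemma singular_values_gram:
  fixes V :: "'a::{conjugatable_ordered_field, real_normed_field} mat"
  assumes V: "V \<in> carrier_mat l d" and "l \<le> d"
  shows "singular_values (mat_adjoint V * V) =
    singular_values (four_block_mat (V * mat_adjoint V)
      (0\<^sub>m l (d - l)) (0\<^sub>m (d - l) l) (0\<^sub>m (d - l) (d - l)))"
proof (rule singular_values_cong)
  let ?A = "V * mat_adjoint V" and ?t = "d - l"
  let ?Z = "four_block_mat ?A (0\<^sub>m l ?t) (0\<^sub>m ?t l) (0\<^sub>m ?t ?t)"
  have A: "?A \<in> carrier_mat l l" and W: "mat_adjoint V \<in> carrier_mat d l" using V by auto
  have adj: "mat_adjoint ?A = ?A" "mat_adjoint (mat_adjoint V * V) = mat_adjoint V * V"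
    using V W by (simp_all add: mat_adjoint_mult[OF V W] mat_adjoint_mult[OF W V])
  have "mat_adjoint ?Z * ?Z = four_block_mat (?A * ?A) (0\<^sub>m l ?t) (0\<^sub>m ?t l) (0\<^sub>m ?t ?t)"
    using A by (subst mat_adjoint_four_block[of _ l l _ ?t _ ?t])
      (auto simp: adj mult_four_block_mat[of _ l l _ ?t _ ?t _ _ l _ ?t])
  hence "char_poly (mat_adjoint ?Z * ?Z) = char_poly (?A * ?A) * [:0, 1:] ^ ?t"
    using A by (simp add: char_poly_four_block_upper_right_zero char_poly_zero_mat)
  \<comment> \<open>The square is regrouped as a product of the \<open>d\<close> by \<open>l\<close>
    matrix \<open>mat_adjoint V\<close> and the \<open>l\<close> by \<open>d\<close> matrix
    \<open>?A * V\<close>; exchanging the two factors yields \<open>?A * ?A\<close>.\<close>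
  moreover have "mat_adjoint (mat_adjoint V * V) * (mat_adjoint V * V) = mat_adjoint V * (?A * V)"
    using V W by (simp only: adj assoc_mult_mat[OF W V mult_carrier_mat[OF W V]] assoc_mult_mat[OF V W V])
  moreover have "?A * V * mat_adjoint V = ?A * ?A"
    using V W A by (simp add: assoc_mult_mat[of _ l l _ d _ l])
  ultimately show "char_poly (mat_adjoint (mat_adjoint V * V) * (mat_adjoint V * V)) =
      char_poly (mat_adjoint ?Z * ?Z)"
    using char_poly_mult_commute[of "mat_adjoint V" d l "?A * V"] V W A \<open>l \<le> d\<close> by simp
qed

text \<open>The norm depends only on the singular values, so the Gram matrix may be replaced by the
  zero-padded \<open>?Z\<close>; compatibility then removes the padding.\<close>

lemma norm_gram:
  fixes V :: "'a::{conjugatable_ordered_field, real_normed_field} mat"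
  assumes "compatible_ui_norm N" "associated_gauge N \<psi>"
    and V: "V \<in> carrier_mat l d" and "0 < l" "l \<le> d"
  shows "N d (mat_adjoint V * V) = N l (V * mat_adjoint V)"
proof -
  let ?A = "V * mat_adjoint V" and ?t = "d - l"
  let ?Z = "four_block_mat ?A (0\<^sub>m l ?t) (0\<^sub>m ?t l) (0\<^sub>m ?t ?t)"
  have A: "?A \<in> carrier_mat l l" using V by auto
  have Z: "?Z \<in> carrier_mat d d"
    using four_block_carrier_mat[OF A zero_carrier_mat[of ?t ?t]] \<open>l \<le> d\<close> by simp
  have "N d (mat_adjoint V * V) = \<psi> d (singular_values (mat_adjoint V * V))"
    using assms(2,4,5) mult_carrier_mat[OF mat_adjoint_carrier[OF V] V]
    unfolding associated_gauge_def by (metis order_less_le_trans)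
  also have "\<dots> = N d ?Z"
    using assms(2,4,5) Z unfolding associated_gauge_def singular_values_gram[OF V \<open>l \<le> d\<close>]
    by (metis order_less_le_trans)
  also have "\<dots> = N (l + ?t) ?Z" using \<open>l \<le> d\<close> by simp
  also have "\<dots> = N l ?A"
    using assms(1) A \<open>0 < l\<close> unfolding compatible_ui_norm_def by blast
  finally show ?thesis .
qed

text \<open>This identifies \<open>eta\<close> with the norm of the identity matrix divided by its
  size.\<close>

lemma singular_values_one:
  "singular_values (1\<^sub>m n :: 'a::{conjugatable_ordered_field, real_normed_field} mat) = vec n (\<lambda>_. 1)"
proof -
  have "char_poly (1\<^sub>m n :: 'a mat) = [:-1, 1:] ^ n"
    by (subst char_poly_diagonal_const[of _ n 1]) auto
  hence "proots (char_poly (1\<^sub>m n :: 'a mat)) = replicate_mset n 1"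
    by (simp add: proots_power)
  moreover have "sorted_list_of_multiset (replicate_mset n (1::real)) = replicate n 1"
    by (metis mset_replicate sort_replicate sorted_list_of_multiset_mset)
  ultimately show ?thesis
    by (auto simp: singular_values_def vec_of_list_index)
qed

section \<open>Averaging under a unitarily invariant norm\<close>

lemma ui_norm_smult:
  "ui_norm n N \<Longrightarrow> A \<in> carrier_mat n n \<Longrightarrow> N (c \<cdot>\<^sub>m A) = norm c * N A"
  by (simp add: ui_norm_def)

text \<open>The new matrix is \<open>A\<close> conjugated by the signed permutation matrix
  \<open>U\<close>, which is unitary because \<open>p\<close> is injective and every sign squares to
  1. Reflections are the case where \<open>p\<close> is the identity, cyclic shifts the case where
  all signs are 1.\<close>

lemma ui_norm_signed_permutation:
  fixes A :: "'a::{conjugatable_ordered_field, real_normed_field} mat"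
  assumes N: "ui_norm n N" and A: "A \<in> carrier_mat n n"
    and p: "inj_on p {..<n}" "\<And>i. i < n \<Longrightarrow> p i < n"
    and e: "\<And>i. i < n \<Longrightarrow> e i = 1 \<or> e i = -1"
  shows "N (mat n n (\<lambda>(i, j). e i * e j * A $$ (p i, p j))) = N A"
proof -
  define U where "U = mat n n (\<lambda>(i, j). if j = p i then e i else 0)"
  have U: "U \<in> carrier_mat n n" by (simp add: U_def)
  have Uij: "U $$ (i, j) = (if j = p i then e i else 0)" if "i < n" "j < n" for i j
    using that by (simp add: U_def)
  have ce: "conjugate (e i) = e i" and ee: "e i * e i = 1" if "i < n" for i
    using e[OF that] by (auto simp: conjugate_neg)
  have peq: "p i = p j \<longleftrightarrow> i = j" if "i < n" "j < n" for i j
    using p(1) that by (auto simp: inj_on_def)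
  have UX: "(U * X) $$ (i, j) = e i * X $$ (p i, j)"
    if "X \<in> carrier_mat n n" "i < n" "j < n" for X i j
  proof -
    have "(U * X) $$ (i, j) = (\<Sum>k<n. U $$ (i, k) * X $$ (k, j))"
      using that U by (simp add: index_mult_mat_sum del: index_mult_mat(1))
    also have "\<dots> = (\<Sum>k<n. if k = p i then e i * X $$ (k, j) else 0)"
      using that by (intro sum.cong) (auto simp: Uij)
    finally show ?thesis using p(2)[OF that(2)] by simp
  qed
  have XU: "(X * mat_adjoint U) $$ (i, j) = X $$ (i, p j) * e j"
    if "X \<in> carrier_mat n n" "i < n" "j < n" for X i j
  proof -
    have "(X * mat_adjoint U) $$ (i, j) = (\<Sum>k<n. X $$ (i, k) * conjugate (U $$ (j, k)))"
      using that U by (simp add: index_mult_mat_sum del: index_mult_mat(1))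
    also have "\<dots> = (\<Sum>k<n. if k = p j then X $$ (i, k) * e j else 0)"
      using that by (intro sum.cong) (auto simp: Uij ce)
    finally show ?thesis using p(2)[OF that(3)] by simp
  qed
  have "U * mat_adjoint U = 1\<^sub>m n"
    using U by (intro eq_matI) (auto simp: XU[OF U] Uij peq ee p(2) simp del: index_mult_mat(1))
  hence unit: "mat_unitary n U" "mat_unitary n (mat_adjoint U)"
    using U mat_mult_left_right_inverse[OF U mat_adjoint_carrier[OF U]]
    by (auto simp: mat_unitary_def)
  have "U * A * mat_adjoint U = mat n n (\<lambda>(i, j). e i * e j * A $$ (p i, p j))"
    using A U p(2)
    by (intro eq_matI)
       (auto simp: UX[OF A] XU[OF mult_carrier_mat[OF U A]] simp del: index_mult_mat(1))
  thus ?thesis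
    using N A unit unfolding ui_norm_def by metis
qed

text \<open>
  Averaging a matrix with its conjugate by the reflection in the \<open>k\<close>-th coordinate clears the
  off-diagonal entries of row and column \<open>k\<close>.
\<close>

lemma ui_norm_diagonal_part_le:
  fixes A :: "'a::{conjugatable_ordered_field, real_normed_field} mat"
  assumes N: "ui_norm n N" and A: "A \<in> carrier_mat n n"
  shows "N (mat n n (\<lambda>(i, j). if i = j then A $$ (i, j) else 0)) \<le> N A"
proof -
  \<comment> \<open>In \<open>B k\<close> the off-diagonal entries of the rows and columns with
    index below \<open>k\<close> are cleared, so \<open>B 0\<close> is \<open>A\<close> and
    \<open>B n\<close> is the diagonal part.\<close>
  define B where "B k = mat n n (\<lambda>(i, j). if i = j \<or> k \<le> i \<and> k \<le> j then A $$ (i, j) else 0)" for k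
  have B: "B k \<in> carrier_mat n n" for k by (simp add: B_def)
  have "N (B k) \<le> N A" for k
  proof (induction k)
    case 0
    have "B 0 = A" using A by (auto simp: B_def)
    thus ?case by simp
  next
    case (Suc k)
    define e :: "nat \<Rightarrow> 'a" where "e i = (if i = k then -1 else 1)" for i
    define C where "C = mat n n (\<lambda>(i, j). e i * e j * B k $$ (i, j))"
    have C: "C \<in> carrier_mat n n" by (simp add: C_def)
    have NC: "N C = N (B k)"
      unfolding C_def using ui_norm_signed_permutation[OF N B, of id e k] by (auto simp: e_def)
    \<comment> \<open>The sign product is -1 exactly when one of \<open>i\<close>, \<open>j\<close>
      equals \<open>k\<close> and the other does not. Those entries cancel in the sum; all others
      double.\<close>
    have "B (Suc k) = of_real (1 / 2) \<cdot>\<^sub>m (B k + C)"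
    proof (rule eq_matI)
      fix i j assume "i < dim_row (of_real (1 / 2) \<cdot>\<^sub>m (B k + C))"
        "j < dim_col (of_real (1 / 2) \<cdot>\<^sub>m (B k + C))"
      hence ij: "i < n" "j < n" using C by auto
      show "B (Suc k) $$ (i, j) = (of_real (1 / 2) \<cdot>\<^sub>m (B k + C)) $$ (i, j)"
        using ij by (auto simp: B_def C_def e_def simp flip: mult_2)
    qed (use B C in auto)
    hence "N (B (Suc k)) = 1 / 2 * N (B k + C)"
      using C by (simp add: ui_norm_smult[OF N] norm_divide)
    moreover have "N (B k + C) \<le> N (B k) + N C"
      using N B C unfolding ui_norm_def by blast
    ultimately show ?case using NC Suc by simp
  qed
  moreover have "B n = mat n n (\<lambda>(i, j). if i = j then A $$ (i, j) else 0)"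
    by (rule eq_matI) (auto simp: B_def)
  ultimately show ?thesis by metis
qed

lemma inj_on_add_mod: "inj_on (\<lambda>i. (i + s) mod n) {..<n::nat}"
proof (rule inj_onI)
  fix i j assume ij: "i \<in> {..<n}" "j \<in> {..<n}" "(i + s) mod n = (j + s) mod n"
  \<comment> \<open>Over the integers the shift by \<open>s\<close> can be subtracted again.\<close>
  have "int i mod int n = int j mod int n"
    using arg_cong[OF ij(3), of int]
    by (metis add_diff_cancel_right' mod_diff_left_eq of_nat_add zmod_int)
  thus "i = j" using ij by simp
qed

text \<open>The sum of all \<open>n\<close> cyclic shifts of the diagonal part is the trace times
  the identity, and every shift has the same norm.\<close>

lemma ui_norm_trace_le:
  fixes A :: "'a::{conjugatable_ordered_field, real_normed_field} mat"
  assumes N: "ui_norm n N" and A: "A \<in> carrier_mat n n"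
  shows "norm (mat_trace A) * N (1\<^sub>m n) \<le> real n * N A"
proof -
  define D where "D = mat n n (\<lambda>(i, j). if i = j then A $$ (i, j) else 0)"
  have D: "D \<in> carrier_mat n n" by (simp add: D_def)
  \<comment> \<open>Partial sums of the shifts, so that the triangle inequality applies by
    induction.\<close>
  define S where "S k = mat n n (\<lambda>(i, j). \<Sum>s<k. D $$ ((i + s) mod n, (j + s) mod n))" for k
  have S: "S k \<in> carrier_mat n n" for k by (simp add: S_def)
  have "N (S k) \<le> real k * N D" for k
  proof (induction k)
    case 0
    have "S 0 = 0\<^sub>m n n" by (auto simp: S_def)
    moreover have "N (0\<^sub>m n n) = 0" using N unfolding ui_norm_def by (metis zero_carrier_mat)
    ultimately show ?case by simp
  next
    case (Suc k)
    define R where "R = mat n n (\<lambda>(i, j). D $$ ((i + k) mod n, (j + k) mod n))"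
    have R: "R \<in> carrier_mat n n" by (simp add: R_def)
    have "N R = N D"
      using ui_norm_signed_permutation[OF N D inj_on_add_mod[of k n], of "\<lambda>_. 1"] by (simp add: R_def)
    moreover have "S (Suc k) = S k + R" by (rule eq_matI) (auto simp: S_def R_def)
    moreover have "N (S k + R) \<le> N (S k) + N R" using N S R unfolding ui_norm_def by blast
    ultimately show ?case using Suc by (simp add: algebra_simps)
  qed
  moreover have "S n = mat_trace A \<cdot>\<^sub>m 1\<^sub>m n"
  proof (rule eq_matI)
    fix i j assume "i < dim_row (mat_trace A \<cdot>\<^sub>m 1\<^sub>m n)" "j < dim_col (mat_trace A \<cdot>\<^sub>m 1\<^sub>m n)"
    hence ij: "i < n" "j < n" by auto
    \<comment> \<open>A common shift moves off-diagonal positions to off-diagonal positions, where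
      \<open>D\<close> vanishes.\<close>
    have eq: "(s + i) mod n = (s + j) mod n \<longleftrightarrow> i = j" for s
      using inj_on_eq_iff[OF inj_on_add_mod[of s n], of i j] ij by (simp add: add.commute)
    \<comment> \<open>As \<open>s\<close> varies, each diagonal entry of \<open>A\<close> is met
      exactly once at position \<open>i\<close>, so the sum there is the trace.\<close>
    have "bij_betw (\<lambda>s. (s + i) mod n) {..<n} {..<n}"
      unfolding bij_betw_def
      using inj_on_add_mod[of i n] ij by (intro conjI endo_inj_surj) auto
    hence "(\<Sum>s<n. A $$ ((s + i) mod n, (s + i) mod n)) = (\<Sum>s<n. A $$ (s, s))"
      by (rule sum.reindex_bij_betw)
    thus "S n $$ (i, j) = (mat_trace A \<cdot>\<^sub>m 1\<^sub>m n) $$ (i, j)"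
      using ij A by (auto simp: S_def D_def eq mat_trace_def add.commute)
  qed (auto simp: S_def)
  moreover have "N (mat_trace A \<cdot>\<^sub>m 1\<^sub>m n) = norm (mat_trace A) * N (1\<^sub>m n)"
    using N by (simp add: ui_norm_smult)
  ultimately have "norm (mat_trace A) * N (1\<^sub>m n) \<le> real n * N D" by metis
  also have "\<dots> \<le> real n * N A"
    using ui_norm_diagonal_part_le[OF N A] by (simp add: D_def mult_left_mono)
  finally show ?thesis .
qed

section \<open>Full column rank and scaled projections\<close>

text \<open>Linear independence here concerns the set of columns, so in both directions the columns
  must first be shown distinct; after that a kernel vector is the same as a linear relation between
  the columns.\<close>

lemma (in vec_space) rank_eq_dim_col_iff:
  assumes A: "A \<in> carrier_mat n nc"
  shows "rank A = nc \<longleftrightarrow> (\<forall>v\<in>carrier_vec nc. A *\<^sub>v v = 0\<^sub>v n \<longrightarrow> v = 0\<^sub>v nc)"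
proof
  assume r: "rank A = nc"
  \<comment> \<open>The rank is the size of a maximal independent set of columns. If it equals
    \<open>nc\<close>, there are at least \<open>nc\<close> different columns.\<close>
  obtain S where S: "maximal S (\<lambda>T. T \<subseteq> set (cols A) \<and> lin_indpt T)"
    using maximal_exists[of "(\<lambda>T. T \<subseteq> set (cols A) \<and> lin_indpt T)" "card (set (cols A))" "{}"]
    by (meson List.finite_set card_mono empty_iff empty_subsetI finite_lin_indpt2 rev_finite_subset)
  hence "card S \<le> card (set (cols A))" by (simp add: card_mono maximal_def)
  hence "nc \<le> card (set (cols A))" using rank_card_indpt[OF A S] r by simp
  hence dist: "distinct (cols A)"
    using A card_length[of "cols A"] by (intro card_distinct) auto
  thus "\<forall>v\<in>carrier_vec nc. A *\<^sub>v v = 0\<^sub>v n \<longrightarrow> v = 0\<^sub>v nc"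
    using full_rank_lin_indpt[OF A r dist] lin_depI[OF A _ _ _ dist] by blast
next
  assume inj: "\<forall>v\<in>carrier_vec nc. A *\<^sub>v v = 0\<^sub>v n \<longrightarrow> v = 0\<^sub>v nc"
  have dist: "distinct (cols A)"
    unfolding distinct_conv_nth
  proof (intro allI impI notI)
    fix i j assume ij: "i < length (cols A)" "j < length (cols A)" "i \<noteq> j" "cols A ! i = cols A ! j"
    hence lt: "i < nc" "j < nc" using A by auto
    have col: "A *\<^sub>v unit_vec nc k = col A k" if "k < nc" for k
      using that A by (intro eq_vecI) auto
    \<comment> \<open>Two equal columns would put a nonzero difference of unit vectors into the
      kernel.\<close>
    have "A *\<^sub>v (unit_vec nc i - unit_vec nc j) = A *\<^sub>v unit_vec nc i - A *\<^sub>v unit_vec nc j"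
      using A by (intro mult_minus_distrib_mat_vec) auto
    also have "\<dots> = 0\<^sub>v n"
      using ij lt A by (simp add: col)
    finally have "unit_vec nc i - unit_vec nc j = (0\<^sub>v nc :: 'a vec)"
      by (intro inj[rule_format] minus_carrier_vec unit_vec_carrier)
    hence "(unit_vec nc i - unit_vec nc j) $ i = (0 :: 'a)" using lt by simp
    thus False using lt ij(3) by simp
  qed
  show "rank A = nc"
    using lin_indpt_full_rank[OF A dist] lin_depE[OF A _ dist] inj by blast
qed

lemma mat_mult_left_cancel_of_injective:
  fixes A :: "'a::comm_ring_1 mat"
  assumes A: "A \<in> carrier_mat n k" and X: "X \<in> carrier_mat k p" and Y: "Y \<in> carrier_mat k p"
    and inj: "\<forall>v\<in>carrier_vec k. A *\<^sub>v v = 0\<^sub>v n \<longrightarrow> v = 0\<^sub>v k"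
    and eq: "A * X = A * Y"
  shows "X = Y"
proof (rule mat_col_eqI)
  fix j assume "j < dim_col Y"
  hence j: "j < p" using Y by simp
  have "A *\<^sub>v (col X j - col Y j) = A *\<^sub>v col X j - A *\<^sub>v col Y j"
    using A X Y by (intro mult_minus_distrib_mat_vec) auto
  also have "\<dots> = col (A * X) j - col (A * Y) j"
    using X Y j by (simp add: col_mult2[OF A X j] col_mult2[OF A Y j])
  also have "\<dots> = 0\<^sub>v n"
    unfolding eq using A by (intro minus_cancel_vec) (auto simp: col_def)
  finally have z: "col X j - col Y j = 0\<^sub>v k" using X Y by (intro inj[rule_format] carrier_vecI) auto
  show "col X j = col Y j"
  proof (rule eq_vecI)
    fix i assume "i < dim_vec (col Y j)"
    hence i: "i < k" using Y by simp
    have "(col X j - col Y j) $ i = 0" using i by (simp add: z)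
    thus "col X j $ i = col Y j $ i" using i X Y by simp
  qed (use X Y in simp)
qed (use X Y in auto)

text \<open>Full rank makes \<open>?W\<close> injective, hence cancellable on the left. Idempotence
  of \<open>P\<close> says that \<open>?W * V\<close> squares to \<open>w\<close> times itself, and
  cancelling \<open>?W\<close> twice leaves the right side. Conversely, that identity makes
  \<open>?W * V\<close> divided by \<open>w\<close> idempotent and \<open>?W\<close>
  injective.\<close>

lemma scaled_projection_full_rank_iff:
  fixes V :: "'a::{conjugatable_field, real_normed_field} mat"
  assumes conj_real: "\<And>r. conjugate (of_real r :: 'a) = of_real r"
    and V: "V \<in> carrier_mat l d" and w: "w > 0"
  shows "(\<exists>P. orth_projection d P \<and> mat_adjoint V * V = of_real w \<cdot>\<^sub>m P) \<and>
      vec_space.rank d (mat_adjoint V) = l \<longleftrightarrow>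
    V * mat_adjoint V = of_real w \<cdot>\<^sub>m 1\<^sub>m l" (is "?L \<longleftrightarrow> ?R")
proof -
  let ?W = "mat_adjoint V" and ?w = "of_real w :: 'a"
  have W: "?W \<in> carrier_mat d l" using V by auto
  have WV: "?W * V \<in> carrier_mat d d" and VW: "V * ?W \<in> carrier_mat l l" using V W by auto
  have rank: "vec_space.rank d ?W = l \<longleftrightarrow>
      (\<forall>v\<in>carrier_vec l. ?W *\<^sub>v v = 0\<^sub>v d \<longrightarrow> v = 0\<^sub>v l)"
    by (rule vec_space.rank_eq_dim_col_iff[OF W])
  have sq: "?W * V * (?W * V) = ?W * (V * ?W * V)"
    by (simp only: assoc_mult_mat[OF W V WV] assoc_mult_mat[OF V W V])
  show ?thesis
  proof
    assume ?L
    then obtain P where P: "P \<in> carrier_mat d d" "P * P = P" "?W * V = ?w \<cdot>\<^sub>m P"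
      and r: "vec_space.rank d ?W = l"
      by (auto simp: orth_projection_def)
    note inj = rank[THEN iffD1, OF r]
    have "?W * V * (?W * V) = ?w \<cdot>\<^sub>m (?w \<cdot>\<^sub>m (P * P))"
      using P(1) by (simp add: P(3) mult_smult_assoc_mat[of _ d d _ d] mult_smult_distrib[of _ d d _ d])
    also have "\<dots> = ?W * (?w \<cdot>\<^sub>m V)"
      by (simp add: P(2) mult_smult_distrib[OF W V] flip: P(3))
    finally have "?W * (V * ?W * V) = ?W * (?w \<cdot>\<^sub>m V)" by (simp only: sq)
    hence "V * ?W * V = ?w \<cdot>\<^sub>m V"
      by (rule mat_mult_left_cancel_of_injective[OF W mult_carrier_mat[OF VW V]
            smult_carrier_mat[OF V] inj])
    \<comment> \<open>Taking adjoints brings \<open>?W\<close> to the front again, ready for the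
      second cancellation.\<close>
    hence "mat_adjoint (V * ?W * V) = mat_adjoint (?w \<cdot>\<^sub>m V)" by simp
    hence "?W * (V * ?W) = ?W * (?w \<cdot>\<^sub>m 1\<^sub>m l)"
      by (simp add: mat_adjoint_mult[OF VW V] right_mult_one_mat[OF W] mat_adjoint_mult[OF V W] mat_adjoint_smult
          conj_real mult_smult_distrib[OF W one_carrier_mat])
    thus ?R
      by (rule mat_mult_left_cancel_of_injective[OF W VW smult_carrier_mat[OF one_carrier_mat] inj])
  next
    assume R: ?R
    define u :: 'a where "u = of_real (1 / w)"
    have u: "u * ?w = 1" "?w * u = 1" "conjugate u = u"
      using w unfolding u_def by (simp_all only: conj_real flip: of_real_mult) simp_all
    define P where "P = u \<cdot>\<^sub>m (?W * V)"
    have P: "P \<in> carrier_mat d d" using WV by (simp add: P_def)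
    have sq': "?W * V * (?W * V) = ?w \<cdot>\<^sub>m (?W * V)"
      unfolding sq R by (simp add: mult_smult_assoc_mat[OF one_carrier_mat V] left_mult_one_mat[OF V]
          mult_smult_distrib[OF W V])
    have "P * P = u \<cdot>\<^sub>m (u \<cdot>\<^sub>m (?W * V * (?W * V)))"
      unfolding P_def mult_smult_assoc_mat[OF WV smult_carrier_mat[OF WV]] mult_smult_distrib[OF WV WV] ..
    also have "\<dots> = P" unfolding sq' P_def by (intro eq_matI) (simp_all add: u flip: mult.assoc)
    finally have "P * P = P" .
    moreover have "mat_adjoint P = P"
      by (simp add: P_def mat_adjoint_smult u mat_adjoint_mult[OF W V])
    moreover have "?W * V = ?w \<cdot>\<^sub>m P"
      unfolding P_def by (intro eq_matI) (simp_all add: u flip: mult.assoc)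
    moreover have "v = 0\<^sub>v l" if v: "v \<in> carrier_vec l" "?W *\<^sub>v v = 0\<^sub>v d" for v
    proof -
      \<comment> \<open>Applying \<open>V\<close> to a kernel vector of \<open>?W\<close> multiplies
        it by the nonzero scalar \<open>?w\<close>.\<close>
      have "?w \<cdot>\<^sub>v v = V *\<^sub>v (?W *\<^sub>v v)"
        unfolding assoc_mult_mat_vec[OF V W v(1), symmetric] R
        using v(1) by (intro eq_vecI) auto
      also have "\<dots> = 0\<^sub>v l" unfolding v(2) using V by (intro eq_vecI) auto
      finally have z: "?w \<cdot>\<^sub>v v = 0\<^sub>v l" .
      show ?thesis
      proof (rule eq_vecI)
        fix i assume "i < dim_vec (0\<^sub>v l :: 'a vec)"
        thus "v $ i = 0\<^sub>v l $ i" using arg_cong[OF z, of "\<lambda>u. u $ i"] v w by simp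
      qed (use v in simp)
    qed
    ultimately show ?L using P rank by (auto simp: orth_projection_def)
  qed
qed

section \<open>The error operator for one lost packet\<close>

text \<open>Subtracting the retained coordinates from the full Gram sum leaves those of packet
  \<open>i\<close> alone, namely the \<open>k\<close> with \<open>k div l = i\<close>.\<close>

lemma gram_minus_gram_packet_lost:
  fixes V :: "nat \<Rightarrow> 'a::conjugatable_field mat"
  assumes V: "\<And>i. i < m \<Longrightarrow> V i \<in> carrier_mat l d" and i: "i < m"
  defines "T \<equiv> analysis_op m l d V"
  shows "mat_adjoint T * T - mat_adjoint T * packet_lost m l {i} * T = mat_adjoint (V i) * V i"
proof (rule eq_matI)
  have T: "T \<in> carrier_mat (m * l) d" by (simp add: T_def analysis_op_def)
  let ?E = "packet_lost m l {i} :: 'a mat"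
  have E: "?E \<in> carrier_mat (m * l) (m * l)" by (simp add: packet_lost_def)
  have Vi: "V i \<in> carrier_mat l d" using V i by simp
  show "dim_row (mat_adjoint T * T - mat_adjoint T * ?E * T) = dim_row (mat_adjoint (V i) * V i)"
    "dim_col (mat_adjoint T * T - mat_adjoint T * ?E * T) = dim_col (mat_adjoint (V i) * V i)"
    using T Vi by auto
  fix r c assume "r < dim_row (mat_adjoint (V i) * V i)" "c < dim_col (mat_adjoint (V i) * V i)"
  hence rc: "r < d" "c < d" using Vi by auto
  let ?f = "\<lambda>k. conjugate (T $$ (k, r)) * T $$ (k, c)"
  have TT: "(mat_adjoint T * T) $$ (r, c) = (\<Sum>k<m * l. ?f k)"
    using T rc by (simp add: index_mult_mat_sum del: index_mult_mat(1))
  have TE: "(mat_adjoint T * ?E) $$ (r, k) = (if k div l = i then 0 else conjugate (T $$ (k, r)))"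
    if k: "k < m * l" for k
  proof -
    have "(mat_adjoint T * ?E) $$ (r, k) = (\<Sum>k'<m * l. conjugate (T $$ (k', r)) * ?E $$ (k', k))"
      using T E rc k by (simp add: index_mult_mat_sum del: index_mult_mat(1))
    also have "\<dots> = (\<Sum>k'<m * l. if k' = k then if k div l = i then 0 else conjugate (T $$ (k, r)) else 0)"
      using k by (intro sum.cong) (auto simp: packet_lost_def)
    finally show ?thesis using k by simp
  qed
  have "(mat_adjoint T * ?E * T) $$ (r, c) = (\<Sum>k<m * l. (mat_adjoint T * ?E) $$ (r, k) * T $$ (k, c))"
    using T E rc by (simp add: index_mult_mat_sum[of r "mat_adjoint T * ?E" c T] del: index_mult_mat(1))
  also have "\<dots> = (\<Sum>k<m * l. if k div l = i then 0 else ?f k)"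
    by (intro sum.cong) (auto simp: TE simp del: index_mult_mat(1))
  finally have TET: "(mat_adjoint T * ?E * T) $$ (r, c) = (\<Sum>k<m * l. if k div l = i then 0 else ?f k)" .
  have "(mat_adjoint T * T - mat_adjoint T * ?E * T) $$ (r, c) =
      (\<Sum>k<m * l. ?f k) - (\<Sum>k<m * l. if k div l = i then 0 else ?f k)"
    using T E rc by (simp add: TT TET del: index_mult_mat(1))
  also have "\<dots> = (\<Sum>k<m * l. if k div l = i then ?f k else 0)"
    by (subst sum_subtractf[symmetric]) (auto intro!: sum.cong)
  also have "\<dots> = (\<Sum>k\<in>{k. k < m * l \<and> k div l = i}. ?f k)"
    by (subst sum.inter_filter[symmetric]) (auto intro!: sum.cong)
  also have "\<dots> = (\<Sum>j<l. conjugate (V i $$ (j, r)) * V i $$ (j, c))"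
  proof (rule sum.reindex_bij_witness[where i = "\<lambda>j. i * l + j" and j = "\<lambda>k. k mod l"])
    fix k assume k: "k \<in> {k. k < m * l \<and> k div l = i}"
    hence l: "0 < l" by (cases l) auto
    show "i * l + k mod l = k" using k by auto
    show "k mod l \<in> {..<l}" using l by simp
    show "conjugate (V i $$ (k mod l, r)) * V i $$ (k mod l, c) = ?f k"
      using k rc by (auto simp: T_def analysis_op_def)
  next
    fix j assume j: "j \<in> {..<l}"
    show "(i * l + j) mod l = j" using j by simp
    have "i * l + j < (i + 1) * l" using j by simp
    also have "\<dots> \<le> m * l" using i by (intro mult_right_mono) auto
    finally show "i * l + j \<in> {k. k < m * l \<and> k div l = i}" using j by simp
  qed
  also have "\<dots> = (mat_adjoint (V i) * V i) $$ (r, c)"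
    using Vi rc by (simp add: index_mult_mat_sum del: index_mult_mat(1))
  finally show "(mat_adjoint T * T - mat_adjoint T * ?E * T) $$ (r, c) =
      (mat_adjoint (V i) * V i) $$ (r, c)" .
qed

lemma worst_error_1:
  assumes "\<And>i. i < m \<Longrightarrow> V i \<in> carrier_mat l d"
  shows "worst_error N m l d V 1 = Max ((\<lambda>i. N d (mat_adjoint (V i) * V i)) ` {..<m})"
proof -
  have "{K. K \<subseteq> {..<m} \<and> card K = 1} = (\<lambda>i. {i}) ` {..<m}"
    by (auto simp: card_1_singleton_iff)
  thus ?thesis
    using gram_minus_gram_packet_lost[OF assms]
    by (auto simp: worst_error_def Let_def image_image intro!: arg_cong[where f = Max] image_cong)
qed

section \<open>Traces of the packets, the bound and the equality case\<close>

text \<open>Exchanging the factors under the trace turns the sum into the trace of the resolution of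
  the identity.\<close>

lemma sum_trace_gram:
  assumes "protocol m l d V"
  shows "(\<Sum>i<m. mat_trace (V i * mat_adjoint (V i))) = of_nat d"
proof -
  have V: "V i \<in> carrier_mat l d" if "i < m" for i
    using assms that by (simp add: protocol_def)
  have one: "mat d d (\<lambda>(r, c). \<Sum>i<m. (mat_adjoint (V i) * V i) $$ (r, c)) = 1\<^sub>m d"
    using assms by (simp add: protocol_def)
  have "(\<Sum>i<m. mat_trace (V i * mat_adjoint (V i))) = (\<Sum>i<m. mat_trace (mat_adjoint (V i) * V i))"
    using V by (intro sum.cong refl mat_trace_mult_commute[of _ l d]) auto
  also have "\<dots> = (\<Sum>i<m. \<Sum>r<d. (mat_adjoint (V i) * V i) $$ (r, r))"
    using V by (intro sum.cong refl) (auto simp: mat_trace_def simp del: index_mult_mat(1))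
  also have "\<dots> = (\<Sum>r<d. \<Sum>i<m. (mat_adjoint (V i) * V i) $$ (r, r))"
    by (rule sum.swap)
  also have "\<dots> = (\<Sum>r<d. 1\<^sub>m d $$ (r, r))"
    unfolding one[symmetric] by (intro sum.cong refl) simp
  finally show ?thesis by simp
qed

text \<open>The trace is the sum of the squared moduli of the entries of \<open>V\<close>.\<close>

lemma trace_gram_nonneg:
  fixes V :: "'a::conjugatable_ordered_field mat"
  assumes "V \<in> carrier_mat l d"
  shows "0 \<le> mat_trace (V * mat_adjoint V)"
  using assms
  by (auto simp: mat_trace_def index_mult_mat_sum conjugate_square_positive
      simp del: index_mult_mat(1) intro!: sum_nonneg)

text \<open>
  The common sort of the real and complex numbers does not relate \<^const>\<open>conjugate\<close> and the order to
  the real line; the first two assumptions supply this.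
\<close>

lemma worst_error_1_bound:
  fixes V :: "nat \<Rightarrow> 'a::{conjugatable_ordered_field, real_normed_field} mat"
  assumes conj_real: "\<And>r. conjugate (of_real r :: 'a) = of_real r"
    and nonneg_real: "\<And>z :: 'a. 0 \<le> z \<Longrightarrow> of_real (norm z) = z"
    and ld: "l < d" "d < m * l"
    and N: "compatible_ui_norm N" "associated_gauge N \<psi>" and V: "protocol m l d V"
  shows "worst_error N m l d V 1 \<ge> real d * eta \<psi> l / real m \<and>
    (strict_norm N \<psi> \<longrightarrow>
      (worst_error N m l d V 1 = real d * eta \<psi> l / real m \<longleftrightarrow>
       uwp_protocol m l d V \<and> rank_l m l d V))"
proof -
  have l: "0 < l" and m: "0 < m" using ld by (auto intro!: Nat.gr0I)
  have Vc: "V i \<in> carrier_mat l d" if "i < m" for i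
    using V that by (simp add: protocol_def)
  define a where "a i = V i * mat_adjoint (V i)" for i
  define t where "t i = norm (mat_trace (a i))" for i
  define W where "W = worst_error N m l d V 1"
  define h where "h = eta \<psi> l"
  \<comment> \<open>The only possible common weight: \<open>m\<close> copies of \<open>c\<close>
    times the identity of size \<open>l\<close> have total trace \<open>d\<close>.\<close>
  define c where "c = real d / (real m * real l)"
  have ac: "a i \<in> carrier_mat l l" if "i < m" for i
    using Vc[OF that] by (auto simp: a_def)
  have uiN: "ui_norm l (N l)" using N l by (simp add: compatible_ui_norm_def)
  have N1: "N l (1\<^sub>m l) = real l * h"
    using N(2) l by (auto simp: associated_gauge_def singular_values_one h_def eta_def)
  \<comment> \<open>Definiteness of the norm at the nonzero identity matrix gives
    \<open>h > 0\<close>, which permits division by \<open>h\<close> below.\<close>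
  have "(1\<^sub>m l :: 'a mat) \<noteq> 0\<^sub>m l l"
  proof
    assume eq: "(1\<^sub>m l :: 'a mat) = 0\<^sub>m l l"
    have "(1\<^sub>m l :: 'a mat) $$ (0, 0) = 0" unfolding eq using l by simp
    thus False using l by simp
  qed
  moreover have "0 \<le> N l (1\<^sub>m l) \<and> (N l (1\<^sub>m l) = 0 \<longleftrightarrow> 1\<^sub>m l = (0\<^sub>m l l :: 'a mat))"
    by (rule bspec[OF conjunct1[OF uiN[unfolded ui_norm_def]] one_carrier_mat])
  ultimately have "N l (1\<^sub>m l) \<noteq> 0" "N l (1\<^sub>m l) \<ge> 0" by blast+
  hence "0 < real l * h" unfolding N1 by linarith
  hence h: "h > 0" by (simp add: zero_less_mult_iff)
  have Nsc: "N l (of_real w \<cdot>\<^sub>m 1\<^sub>m l) = w * (real l * h)" if "w \<ge> 0" for w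
    using uiN that by (simp add: ui_norm_smult N1)
  have W: "W = Max ((\<lambda>i. N l (a i)) ` {..<m})"
  proof -
    have "N d (mat_adjoint (V i) * V i) = N l (a i)" if "i < m" for i
      unfolding a_def using norm_gram[OF N Vc[OF that] l] ld by simp
    hence "(\<lambda>i. N d (mat_adjoint (V i) * V i)) ` {..<m} = (\<lambda>i. N l (a i)) ` {..<m}"
      by (intro image_cong) auto
    moreover have "W = Max ((\<lambda>i. N d (mat_adjoint (V i) * V i)) ` {..<m})"
      unfolding W_def by (rule worst_error_1) (rule Vc)
    ultimately show ?thesis by simp
  qed
  have le_W: "N l (a i) \<le> W" if "i < m" for i
    unfolding W using that by (intro Max_ge) auto
  have t_le: "t i * h \<le> N l (a i)" if "i < m" for i
  proof -
    have "real l * (t i * h) \<le> real l * N l (a i)"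
      using ui_norm_trace_le[OF uiN ac[OF that]] by (simp add: N1 t_def mult_ac)
    thus ?thesis using l by simp
  qed
  have tr_sum: "(\<Sum>i<m. mat_trace (a i)) = of_nat d"
    using sum_trace_gram[OF V] by (simp add: a_def)
  have tr_real: "of_real (t i) = mat_trace (a i)" if "i < m" for i
    using nonneg_real trace_gram_nonneg[OF Vc[OF that]] by (simp add: a_def t_def)
  have "of_real (\<Sum>i<m. t i) = (of_real (real d) :: 'a)"
    using tr_sum tr_real by simp
  hence t_sum: "(\<Sum>i<m. t i) = real d" by (simp only: of_real_eq_iff)
  have t_le_W: "t i \<le> W / h" if "i < m" for i
    using order_trans[OF t_le le_W] that h by (simp add: pos_le_divide_eq)
  have "real d \<le> (\<Sum>i<m. W / h)"
    unfolding t_sum[symmetric] by (intro sum_mono t_le_W) simp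
  hence ge: "real d * h / real m \<le> W"
    using h m by (simp add: field_simps)
  have "W = real d * h / real m \<longleftrightarrow> (\<forall>i<m. a i = of_real c \<cdot>\<^sub>m 1\<^sub>m l)"
    if strict: "strict_norm N \<psi>"
  proof
    assume eq: "W = real d * h / real m"
    have Wh: "W / h = real d / real m" using h by (simp add: eq)
    \<comment> \<open>The terms are nonnegative by \<open>t_le_W\<close>, so a zero sum makes each
      of them vanish.\<close>
    have "(\<Sum>i<m. W / h - t i) = 0"
      using m by (simp add: sum_subtractf t_sum Wh)
    hence t_eq: "t i = real d / real m" if "i < m" for i
      using that t_le_W Wh by (subst (asm) sum_nonneg_eq_0_iff) auto
    show "\<forall>i<m. a i = of_real c \<cdot>\<^sub>m 1\<^sub>m l"
    proof (intro allI impI)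
      fix i assume i: "i < m"
      \<comment> \<open>The norm is squeezed between \<open>t i * h\<close> and \<open>W\<close>,
        which now coincide.\<close>
      have "N l (a i) = t i * h"
        using t_le[OF i] le_W[OF i] by (simp add: t_eq[OF i] eq)
      hence "of_real (N l (a i)) = mat_trace (a i) * of_real (eta \<psi> l)"
        by (simp add: h_def tr_real[OF i])
      moreover have "psd l (a i)" unfolding a_def using psd_mult_adjoint[OF Vc[OF i]] .
      ultimately have "a i = (mat_trace (a i) / of_nat l) \<cdot>\<^sub>m 1\<^sub>m l"
        using strict l unfolding strict_norm_def by blast
      also have "mat_trace (a i) / of_nat l = of_real c"
        by (simp add: tr_real[OF i, symmetric] t_eq[OF i] c_def)
      finally show "a i = of_real c \<cdot>\<^sub>m 1\<^sub>m l" .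
    qed
  next
    assume a: "\<forall>i<m. a i = of_real c \<cdot>\<^sub>m 1\<^sub>m l"
    have "c \<ge> 0" by (simp add: c_def)
    have "(\<lambda>i. N l (a i)) ` {..<m} = {c * (real l * h)}"
      using a m Nsc[OF \<open>c \<ge> 0\<close>] by auto
    thus "W = real d * h / real m"
      using l by (simp add: W c_def)
  qed
  moreover have "uwp_protocol m l d V \<and> rank_l m l d V \<longleftrightarrow> (\<forall>i<m. a i = of_real c \<cdot>\<^sub>m 1\<^sub>m l)"
  proof
    assume "uwp_protocol m l d V \<and> rank_l m l d V"
    then obtain w where w: "projective_weights m d V w" "\<And>i j. i < m \<Longrightarrow> j < m \<Longrightarrow> w i = w j"
      and rank: "rank_l m l d V"
      by (auto simp: uwp_protocol_def)
    have a: "a i = of_real (w 0) \<cdot>\<^sub>m 1\<^sub>m l" if i: "i < m" for i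
    proof -
      have "0 < w i" "\<exists>P. orth_projection d P \<and> mat_adjoint (V i) * V i = of_real (w i) \<cdot>\<^sub>m P"
        using w(1) i by (auto simp: projective_weights_def)
      moreover have "vec_space.rank d (mat_adjoint (V i)) = l"
        using rank i by (simp add: rank_l_def)
      ultimately have "a i = of_real (w i) \<cdot>\<^sub>m 1\<^sub>m l"
        unfolding a_def using scaled_projection_full_rank_iff[OF conj_real Vc[OF i]] by blast
      thus ?thesis using w(2)[OF i m] by simp
    qed
    \<comment> \<open>Computing the total trace in two ways determines the common weight
      \<open>w 0\<close>.\<close>
    have "of_real (real m * (real l * w 0)) = (\<Sum>i<m. mat_trace (a i))"
      using a by (simp add: mat_trace_def)
    hence "of_real (real m * (real l * w 0)) = (of_real (real d) :: 'a)"
      by (simp only: tr_sum of_real_of_nat_eq)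
    hence "real m * (real l * w 0) = real d" by (simp only: of_real_eq_iff)
    hence "w 0 = c" using m l by (simp add: c_def field_simps)
    thus "\<forall>i<m. a i = of_real c \<cdot>\<^sub>m 1\<^sub>m l" using a by simp
  next
    assume a: "\<forall>i<m. a i = of_real c \<cdot>\<^sub>m 1\<^sub>m l"
    have c: "c > 0" using l m ld by (simp add: c_def)
    have "(\<exists>P. orth_projection d P \<and> mat_adjoint (V i) * V i = of_real c \<cdot>\<^sub>m P) \<and>
        vec_space.rank d (mat_adjoint (V i)) = l" if "i < m" for i
      using scaled_projection_full_rank_iff[OF conj_real Vc[OF that] c] a that by (simp add: a_def)
    thus "uwp_protocol m l d V \<and> rank_l m l d V"
      using V c by (auto simp: uwp_protocol_def projective_weights_def rank_l_def
          intro!: exI[of _ "\<lambda>_. c"])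
  qed
  ultimately show ?thesis
    using ge by (simp add: W_def h_def)
qed

theorem theorem4p2:
  fixes m l d :: nat
    and \<psi> :: "nat \<Rightarrow> real vec \<Rightarrow> real"
    and N\<^sub>R :: "nat \<Rightarrow> real mat \<Rightarrow> real" and V\<^sub>R :: "nat \<Rightarrow> real mat"
    and N\<^sub>C :: "nat \<Rightarrow> complex mat \<Rightarrow> real" and V\<^sub>C :: "nat \<Rightarrow> complex mat"
  assumes "l < d" and "d < m * l"
  shows "(compatible_ui_norm N\<^sub>R \<and> associated_gauge N\<^sub>R \<psi> \<and> protocol m l d V\<^sub>R \<longrightarrow>
            worst_error N\<^sub>R m l d V\<^sub>R 1 \<ge> real d * eta \<psi> l / real m \<and>
            (strict_norm N\<^sub>R \<psi> \<longrightarrow>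
              (worst_error N\<^sub>R m l d V\<^sub>R 1 = real d * eta \<psi> l / real m \<longleftrightarrow>
               uwp_protocol m l d V\<^sub>R \<and> rank_l m l d V\<^sub>R))) \<and>
         (compatible_ui_norm N\<^sub>C \<and> associated_gauge N\<^sub>C \<psi> \<and> protocol m l d V\<^sub>C \<longrightarrow>
            worst_error N\<^sub>C m l d V\<^sub>C 1 \<ge> real d * eta \<psi> l / real m \<and>
            (strict_norm N\<^sub>C \<psi> \<longrightarrow>
              (worst_error N\<^sub>C m l d V\<^sub>C 1 = real d * eta \<psi> l / real m \<longleftrightarrow>
               uwp_protocol m l d V\<^sub>C \<and> rank_l m l d V\<^sub>C)))"
proof -
  have real: "of_real (norm z) = z" if "0 \<le> z" for z :: real
    using that by simp
  \<comment> \<open>In the complex order a nonnegative number has imaginary part zero.\<close>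
  have complex: "of_real (norm z) = z" if "0 \<le> z" for z :: complex
    using that by (simp add: less_eq_complex_def cmod_eq_Re complex_eq_iff)
  have conj: "conjugate (of_real r :: real) = of_real r" "conjugate (of_real r :: complex) = of_real r" for r
    by simp_all
  show ?thesis
    using worst_error_1_bound[OF conj(1) real assms] worst_error_1_bound[OF conj(2) complex assms]
    by blast
qed

end
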